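(* Let $s\ge 0$ be a fixed real number. Then, uniformly for real $x>1$ and $n\in\mathbb{N}$, $$\sum_{\substack{k\le x\\ k\text{ regular (mod }n)}}k^s=\frac{x^{s+1}}{s+1}\cdot\frac{\varrho(n)}{n}+O\left(x^s3^{\omega(n)}\right),$$ where the sum is over positive integers $k\le x$ that are regular (mod $n$).
   Context: $\mathbb{N}=\{1,2,\ldots\}$. An integer $k$ is called regular (mod $n$) if there exists $y\in\mathbb{Z}$ with $k^2y\equiv k\pmod n$. $\varrho(n)$ is the number of integers $k\in\{1,\ldots,n\}$ that are regular (mod $n$). $\omega(n)$ is the number of distinct prime factors of $n$. "Uniformly" means that the implied constant depends only on $s$, not on $x$ or $n$. *)

theory Defs
  imports Complex_Main "HOL-Number_Theory.Number_Theory"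
begin

definition regular_mod :: "nat \<Rightarrow> int \<Rightarrow> bool" where
  "regular_mod n k \<longleftrightarrow> (\<exists>y::int. [k\<^sup>2 * y = k] (mod int n))"

definition varrho :: "nat \<Rightarrow> nat" where
  "varrho n = card {k::int. k \<in> {1..int n} \<and> regular_mod n k}"

definition omega :: "nat \<Rightarrow> nat" where
  "omega n = card (prime_factors n)"

end

theory Submission
  imports Defs
begin

text \<open>
  With \<open>n = \<Prod> p^a\<close>, an integer \<open>k\<close> is regular (mod \<open>n\<close>) iff for every prime \<open>p\<close> dividing \<open>n\<close>
  either \<open>p\<close> does not divide \<open>k\<close> or \<open>p^a\<close> does. The indicator of the condition at \<open>p\<close> is
  \<open>1 - [p dvd k] + [p^a dvd k]\<close>; multiplying out over \<open>p\<close> writes the indicator of regularity as a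
  sum of \<open>3^\<omega>(n)\<close> terms \<open>\<plusminus>[d dvd k]\<close> with \<open>d dvd n\<close>. The \<open>s\<close>-th powers of the multiples of \<open>d\<close> up
  to \<open>x\<close> sum to \<open>x^(s+1) / ((s+1)d)\<close> with an error of at most \<open>x^s\<close>, and counting the regular
  \<open>k \<le> n\<close> with the same expansion shows that the signed sum of the \<open>1/d\<close> is \<open>\<rho>(n)/n\<close>.
\<close>

section \<open>Regularity as local divisibility conditions, and its signed expansion\<close>

lemma prod_of_bool:
  assumes "finite A"
  shows "(\<Prod>p\<in>A. of_bool (Q p)) = (of_bool (\<forall>p\<in>A. Q p) :: 'a::comm_semiring_1)"
  using assms by (induction A rule: finite_induct) (auto simp: of_bool_def)

lemma prod_coprime_dvd_iff:
  fixes f :: "'a \<Rightarrow> 'b::semiring_gcd"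
  assumes "finite A" "\<And>i j. i \<in> A \<Longrightarrow> j \<in> A \<Longrightarrow> i \<noteq> j \<Longrightarrow> coprime (f i) (f j)"
  shows "prod f A dvd k \<longleftrightarrow> (\<forall>i\<in>A. f i dvd k)"
  using assms
proof (induction A rule: finite_induct)
  case (insert x A)
  have "coprime (f x) (prod f A)"
    using insert.hyps insert.prems by (intro prod_coprime_right) auto
  then have "f x * prod f A dvd k \<longleftrightarrow> f x dvd k \<and> prod f A dvd k"
    by (meson divides_mult dvd_mult_left dvd_mult_right)
  then show ?case
    using insert by simp
qed simp

lemma coprime_prime_powers:
  fixes p q :: nat
  assumes "prime p" "prime q" "p \<noteq> q"
  shows "coprime (p ^ i) (q ^ j)"
  using assms by (simp add: primes_coprime)

text \<open>Regularity says that \<open>n\<close> divides \<open>k * (k * y - 1)\<close>, a product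
  of coprime factors. A prime dividing \<open>k\<close> cannot divide \<open>k * y - 1\<close>, so
  its whole power in \<open>n\<close> must divide \<open>k\<close>.\<close>

lemma regular_mod_iff:
  assumes "n \<ge> 1"
  shows "regular_mod n (int k) \<longleftrightarrow>
    (\<forall>p\<in>prime_factors n. \<not> p dvd k \<or> p ^ multiplicity p n dvd k)"
proof
  assume "regular_mod n (int k)"
  then obtain y where "[(int k)\<^sup>2 * y = int k] (mod int n)"
    unfolding regular_mod_def by blast
  then have "int n dvd (int k)\<^sup>2 * y - int k"
    by (simp add: cong_iff_dvd_diff)
  also have "(int k)\<^sup>2 * y - int k = int k * (int k * y - 1)"
    by (simp add: algebra_simps power2_eq_square)
  finally have n: "int n dvd int k * (int k * y - 1)" .
  show "\<forall>p\<in>prime_factors n. \<not> p dvd k \<or> p ^ multiplicity p n dvd k"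
  proof (intro ballI disj_imp[THEN iffD2] impI)
    fix p assume p: "p \<in> prime_factors n" and "\<not> \<not> p dvd k"
    then have "int p dvd int k" and pp: "prime (int p)"
      by auto
    then have "\<not> int p dvd int k * y - 1"
      using dvd_diff_right_iff[of "int p" "int k * y" 1] not_prime_unit by auto
    then have "coprime (int p ^ multiplicity p n) (int k * y - 1)"
      using prime_imp_coprime[OF pp, of "int k * y - 1"] by simp
    moreover have "int p ^ multiplicity p n dvd int n"
      by (metis multiplicity_dvd of_nat_dvd_iff of_nat_power)
    ultimately have "int p ^ multiplicity p n dvd int k"
      using n by (meson coprime_dvd_mult_left_iff dvd_trans)
    then show "p ^ multiplicity p n dvd k"
      by (metis of_nat_dvd_iff of_nat_power)
  qed
next
  let ?a = "\<lambda>p. int (p ^ multiplicity p n)"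
  assume *: "\<forall>p\<in>prime_factors n. \<not> p dvd k \<or> p ^ multiplicity p n dvd k"
  \<comment> \<open>An inverse \<open>y\<close> of \<open>k\<close> modulo the prime powers over
    \<open>A\<close> is the witness: these powers divide \<open>k * y - 1\<close>, while the
    remaining ones divide \<open>k\<close> by assumption.\<close>
  define A where "A = {p \<in> prime_factors n. \<not> p dvd k}"
  have "coprime (int k) (prod ?a A)"
  proof (rule prod_coprime_right)
    fix p assume "p \<in> A"
    then have "coprime p k"
      by (auto simp: A_def intro: prime_imp_coprime)
    then show "coprime (int k) (?a p)"
      by (simp add: coprime_commute)
  qed
  then obtain y where "[int k * y = 1] (mod prod ?a A)"
    using cong_solve_coprime_int by blast
  then have y: "prod ?a A dvd int k * y - 1"
    by (simp add: cong_iff_dvd_diff)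
  have "?a p dvd int k * (int k * y - 1)" if p: "p \<in> prime_factors n" for p
  proof (cases "p \<in> A")
    case True
    then have "?a p dvd prod ?a A"
      by (intro dvd_prodI) (auto simp: A_def)
    with y show ?thesis
      by (meson dvd_trans dvd_mult)
  next
    case False
    then have "?a p dvd int k"
      using * p unfolding A_def of_nat_dvd_iff by blast
    then show ?thesis
      by (rule dvd_mult2)
  qed
  then have "prod ?a (prime_factors n) dvd int k * (int k * y - 1)"
    by (intro prod_coprime_dvd_iff[THEN iffD2] coprime_int_iff[THEN iffD2] coprime_prime_powers)
      auto
  moreover have "prod ?a (prime_factors n) = int n"
    using assms prime_factorization_nat[of n] by (metis of_nat_prod less_eq_Suc_le One_nat_def)
  ultimately have "int n dvd (int k)\<^sup>2 * y - int k"
    by (simp add: algebra_simps power2_eq_square)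
  then show "regular_mod n (int k)"
    unfolding regular_mod_def by (auto simp: cong_iff_dvd_diff)
qed

lemma regular_mod_expansion:
  assumes "n \<ge> 1"
  obtains G :: "(nat \<Rightarrow> nat) set" and \<epsilon> :: "(nat \<Rightarrow> nat) \<Rightarrow> real" and d :: "(nat \<Rightarrow> nat) \<Rightarrow> nat"
  where "finite G" "card G = 3 ^ omega n"
    "\<And>g. g \<in> G \<Longrightarrow> \<bar>\<epsilon> g\<bar> = 1" "\<And>g. g \<in> G \<Longrightarrow> d g dvd n"
    "\<And>k. of_bool (regular_mod n (int k)) = (\<Sum>g\<in>G. \<epsilon> g * of_bool (d g dvd k))"
proof
  let ?P = "prime_factors n"
  \<comment> \<open>The indices 0, 1, 2 select the terms 1, \<open>-[p dvd k]\<close> and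
    \<open>[p^a dvd k]\<close> at \<open>p\<close>: \<open>e\<close> gives the exponent,
    \<open>c\<close> the sign. A function \<open>g\<close> in \<open>?G\<close> makes one such
    choice at each prime.\<close>
  define e where "e = (\<lambda>p (i::nat). if i = 0 then 0 else if i = 1 then 1 else multiplicity p n)"
  define c :: "nat \<Rightarrow> real" where "c = (\<lambda>i. if i = 1 then -1 else 1)"
  define d where "d = (\<lambda>g :: nat \<Rightarrow> nat. \<Prod>p\<in>?P. p ^ e p (g p))"
  define \<epsilon> where "\<epsilon> = (\<lambda>g :: nat \<Rightarrow> nat. \<Prod>p\<in>?P. c (g p))"
  let ?G = "?P \<rightarrow>\<^sub>E {..<3::nat}"
  show "finite ?G"
    by (intro finite_PiE) auto
  show "card ?G = 3 ^ omega n"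
    by (simp add: card_PiE omega_def)
  show "\<bar>\<epsilon> g\<bar> = 1" for g
    unfolding \<epsilon>_def abs_prod by (intro prod.neutral) (simp add: c_def)
  show "d g dvd n" for g
  proof -
    have "e p i \<le> multiplicity p n" if "p \<in> ?P" for p i
      using that assms by (auto simp: e_def Suc_le_eq prime_factors_multiplicity)
    then have "d g dvd (\<Prod>p\<in>?P. p ^ multiplicity p n)"
      unfolding d_def by (intro prod_dvd_prod le_imp_power_dvd)
    then show ?thesis
      using assms prime_factorization_nat[of n] by simp
  qed
  show "of_bool (regular_mod n (int k)) = (\<Sum>g\<in>?G. \<epsilon> g * of_bool (d g dvd k))" for k
  proof -
    have "of_bool (regular_mod n (int k)) =
        (\<Prod>p\<in>?P. of_bool (\<not> p dvd k \<or> p ^ multiplicity p n dvd k) :: real)"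
      using regular_mod_iff[OF assms] by (simp add: prod_of_bool)
    also have "\<dots> = (\<Prod>p\<in>?P. \<Sum>i<3. c i * of_bool (p ^ e p i dvd k))"
    proof (intro prod.cong refl)
      fix p assume "p \<in> ?P"
      \<comment> \<open>This excludes the case where \<open>p^a\<close> divides \<open>k\<close> but
        \<open>p\<close> does not, in which the three terms would add up to 2.\<close>
      then have "p dvd p ^ multiplicity p n"
        by (auto simp: prime_factors_multiplicity intro!: dvd_power)
      then have "p dvd k" if "p ^ multiplicity p n dvd k"
        using that dvd_trans by blast
      then show "of_bool (\<not> p dvd k \<or> p ^ multiplicity p n dvd k) =
          (\<Sum>i<3. c i * of_bool (p ^ e p i dvd k))"
        by (auto simp: numeral_3_eq_3 c_def e_def)
    qed
    also have "\<dots> = (\<Sum>g\<in>?G. \<Prod>p\<in>?P. c (g p) * of_bool (p ^ e p (g p) dvd k))"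
      by (rule prod_sum_PiE) auto
    also have "\<dots> = (\<Sum>g\<in>?G. \<epsilon> g * of_bool (d g dvd k))"
    proof (intro sum.cong refl)
      fix g
      have "d g dvd k \<longleftrightarrow> (\<forall>p\<in>?P. p ^ e p (g p) dvd k)"
        unfolding d_def by (intro prod_coprime_dvd_iff coprime_prime_powers) auto
      then show "(\<Prod>p\<in>?P. c (g p) * of_bool (p ^ e p (g p) dvd k)) = \<epsilon> g * of_bool (d g dvd k)"
        by (simp add: prod.distrib prod_of_bool \<epsilon>_def)
    qed
    finally show ?thesis .
  qed
qed

section \<open>Power sums over initial segments and over multiples\<close>

lemma powr_integral_bounds:
  fixes a b s :: real
  assumes "0 \<le> s" "0 \<le> a" "a \<le> b"
  shows "(b - a) * a powr s \<le> b powr (s + 1) / (s + 1) - a powr (s + 1) / (s + 1)"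
    and "b powr (s + 1) / (s + 1) - a powr (s + 1) / (s + 1) \<le> (b - a) * b powr s"
proof -
  let ?F = "\<lambda>t. t powr (s + 1) / (s + 1)"
  have "(b - a) * a powr s \<le> ?F b - ?F a \<and> ?F b - ?F a \<le> (b - a) * b powr s"
  proof (cases "a = b")
    case False
    \<comment> \<open>Since \<open>a\<close> may be 0, the derivative is taken only at positive
      points. The mean value theorem needs it only inside the interval, and then
      \<open>l = z powr s\<close> lies between the endpoint values by monotonicity.\<close>
    have der: "(?F has_real_derivative t powr s) (at t)" if "t > 0" for t
      using that assms by (auto intro!: derivative_eq_intros)
    have "\<exists>l z. a < z \<and> z < b \<and> (?F has_real_derivative l) (at z) \<and> ?F b - ?F a = (b - a) * l"
    proof (rule MVT)
      show "a < b" using False assms by simp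
      show "continuous_on {a..b} ?F"
        using assms by (intro continuous_intros continuous_on_powr') auto
      show "?F differentiable (at t)" if "a < t" "t < b" for t
        using der[of t] that assms real_differentiable_def by force
    qed
    then obtain l z where z: "a < z" "z < b" "(?F has_real_derivative l) (at z)"
      "?F b - ?F a = (b - a) * l" by blast
    then have "l = z powr s"
      using der[of z] assms DERIV_unique by force
    then show ?thesis
      using z assms by (auto intro!: mult_left_mono powr_mono2)
  qed simp
  then show "(b - a) * a powr s \<le> ?F b - ?F a" "?F b - ?F a \<le> (b - a) * b powr s"
    by blast+
qed

lemma sum_powr_bounds:
  fixes s :: real
  assumes "0 \<le> s"
  shows "real m powr (s + 1) / (s + 1) \<le> (\<Sum>j=1..m. real j powr s)"
    and "(\<Sum>j=1..m. real j powr s) \<le> real m powr (s + 1) / (s + 1) + real m powr s"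
proof -
  have "real m powr (s + 1) / (s + 1) \<le> (\<Sum>j=1..m. real j powr s) \<and>
    (\<Sum>j=1..m. real j powr s) \<le> real m powr (s + 1) / (s + 1) + real m powr s"
  proof (induction m)
    case (Suc m)
    have "(\<Sum>j=1..Suc m. real j powr s) = (\<Sum>j=1..m. real j powr s) + real (Suc m) powr s"
      by simp
    \<comment> \<open>On \<open>[m, m + 1]\<close> the right endpoint value bounds the increment of
      the main term above, which gives the lower bound. The left one bounds it below, so the old
      error \<open>m powr s\<close> is absorbed and only the last summand remains.\<close>
    then show ?case
      using Suc.IH powr_integral_bounds[OF assms, of "real m" "real (Suc m)"] by simp
  qed simp
  then show "real m powr (s + 1) / (s + 1) \<le> (\<Sum>j=1..m. real j powr s)"
    "(\<Sum>j=1..m. real j powr s) \<le> real m powr (s + 1) / (s + 1) + real m powr s"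
    by blast+
qed

text \<open>Passing from the floor to \<open>y\<close> changes the main term by at most
  \<open>y powr s\<close>, opposite in sign to the error at the floor, so the constant stays 1.
  Small \<open>y\<close> is included because \<open>x / d\<close> may be below 1 later.\<close>

lemma sum_powr_asymp:
  fixes s y :: real
  assumes "0 \<le> s" "0 < y"
  shows "\<bar>(\<Sum>j=1..nat \<lfloor>y\<rfloor>. real j powr s) - y powr (s + 1) / (s + 1)\<bar> \<le> y powr s"
proof -
  define m where "m = nat \<lfloor>y\<rfloor>"
  have m: "real m \<le> y" "y < real m + 1"
    using assms unfolding m_def by linarith+
  have "real m powr s \<le> y powr s"
    using m assms by (intro powr_mono2) auto
  moreover have "(y - real m) * y powr s \<le> 1 * y powr s"
    using m by (intro mult_right_mono) auto
  moreover have "0 \<le> (y - real m) * real m powr s"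
    using m by simp
  ultimately show ?thesis
    using sum_powr_bounds[OF assms(1), of m] powr_integral_bounds[OF assms(1) _ m(1)]
    unfolding m_def[symmetric] by (auto simp: abs_le_iff)
qed

lemma multiples_le_eq_image:
  assumes "d > 0"
  shows "{k::nat. 1 \<le> k \<and> real k \<le> x \<and> d dvd k} = (*) d ` {1..nat \<lfloor>x / real d\<rfloor>}"
proof -
  have "j \<le> nat \<lfloor>x / real d\<rfloor> \<longleftrightarrow> real (d * j) \<le> x" if "j \<ge> 1" for j
  proof -
    have "j \<le> nat \<lfloor>x / real d\<rfloor> \<longleftrightarrow> int j \<le> \<lfloor>x / real d\<rfloor>"
      using that by linarith
    then show ?thesis
      using assms by (simp add: le_floor_iff field_simps)
  qed
  then show ?thesis
    using assms by (auto elim!: dvdE simp: Suc_le_eq)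
qed

text \<open>Writing \<open>k = d * j\<close> extracts \<open>d powr s\<close>, and the error
  \<open>d powr s * (x / d) powr s\<close> equals \<open>x powr s\<close>. Its independence of
  \<open>d\<close> is what makes the final estimate uniform in \<open>n\<close>.\<close>

lemma sum_powr_multiples:
  fixes s x :: real
  assumes "0 \<le> s" "0 < x" "d > 0"
  shows "\<bar>(\<Sum>k | 1 \<le> k \<and> real k \<le> x \<and> d dvd k. real k powr s) - x powr (s + 1) / (s + 1) / real d\<bar>
    \<le> x powr s"
proof -
  let ?y = "x / real d"
  have "(\<Sum>k | 1 \<le> k \<and> real k \<le> x \<and> d dvd k. real k powr s) =
      (\<Sum>j=1..nat \<lfloor>?y\<rfloor>. real (d * j) powr s)"
    using assms by (subst multiples_le_eq_image, simp, subst sum.reindex) (auto simp: inj_on_def)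
  also have "\<dots> = real d powr s * (\<Sum>j=1..nat \<lfloor>?y\<rfloor>. real j powr s)"
    by (simp add: powr_mult sum_distrib_left)
  finally have sum: "(\<Sum>k | 1 \<le> k \<and> real k \<le> x \<and> d dvd k. real k powr s) = \<dots>" .
  have main: "x powr (s + 1) / (s + 1) / real d = real d powr s * (?y powr (s + 1) / (s + 1))"
    using assms by (simp add: powr_divide powr_add)
  have "\<bar>real d powr s * ((\<Sum>j=1..nat \<lfloor>?y\<rfloor>. real j powr s) - ?y powr (s + 1) / (s + 1))\<bar>
      \<le> real d powr s * ?y powr s"
    using sum_powr_asymp[of s ?y] assms unfolding abs_mult by (intro mult_mono) auto
  also have "\<dots> = x powr s"
    using assms by (simp add: powr_divide)
  finally show ?thesis
    unfolding sum main by (simp add: right_diff_distrib)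
qed

theorem proposition4p2:
  fixes s :: real
  assumes "s \<ge> 0"
  shows "\<exists>C::real. \<forall>x::real. \<forall>n::nat. x > 1 \<longrightarrow> n \<ge> 1 \<longrightarrow>
    \<bar>(\<Sum>k | 1 \<le> k \<and> real k \<le> x \<and> regular_mod n (int k). real k powr s)
       - x powr (s + 1) / (s + 1) * (real (varrho n) / real n)\<bar>
      \<le> C * (x powr s * 3 ^ omega n)"
proof (intro exI[of _ 1] allI impI)
  fix x :: real and n :: nat
  assume x: "x > 1" and n: "n \<ge> 1"
  obtain G :: "(nat \<Rightarrow> nat) set" and \<epsilon> :: "(nat \<Rightarrow> nat) \<Rightarrow> real" and d :: "(nat \<Rightarrow> nat) \<Rightarrow> nat"
    where G: "finite G" "card G = 3 ^ omega n"
      and \<epsilon>: "\<And>g. g \<in> G \<Longrightarrow> \<bar>\<epsilon> g\<bar> = 1" and d: "\<And>g. g \<in> G \<Longrightarrow> d g dvd n"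
      and reg: "\<And>k. of_bool (regular_mod n (int k)) = (\<Sum>g\<in>G. \<epsilon> g * of_bool (d g dvd k))"
    using regular_mod_expansion[OF n] by blast
  have d_pos: "d g > 0" if "g \<in> G" for g
    using d[OF that] n by (auto intro: Nat.gr0I)
  \<comment> \<open>The weight and the cutoff are left free to allow two uses:
    \<open>k powr s\<close> up to \<open>x\<close>, and the constant 1 up to \<open>n\<close>, which
    counts \<open>varrho n\<close>.\<close>
  have expand: "(\<Sum>k | 1 \<le> k \<and> real k \<le> z \<and> regular_mod n (int k). f k) =
      (\<Sum>g\<in>G. \<epsilon> g * (\<Sum>k | 1 \<le> k \<and> real k \<le> z \<and> d g dvd k. f k))" for z :: real and f :: "nat \<Rightarrow> real"
  proof -
    let ?K = "{k. 1 \<le> k \<and> real k \<le> z}"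
    have "?K \<subseteq> {..nat \<lfloor>z\<rfloor>}"
      by (auto simp: le_nat_floor)
    then have fin: "finite ?K"
      using finite_subset by blast
    have filter: "(\<Sum>k | 1 \<le> k \<and> real k \<le> z \<and> Q k. f k) = (\<Sum>k\<in>?K. of_bool (Q k) * f k)" for Q
      by (rule sum.mono_neutral_cong_left) (use fin in auto)
    have "(\<Sum>k\<in>?K. of_bool (regular_mod n (int k)) * f k) =
        (\<Sum>k\<in>?K. \<Sum>g\<in>G. \<epsilon> g * (of_bool (d g dvd k) * f k))"
      by (simp only: reg sum_distrib_right mult.assoc)
    also have "\<dots> = (\<Sum>g\<in>G. \<Sum>k\<in>?K. \<epsilon> g * (of_bool (d g dvd k) * f k))"
      by (rule sum.swap)
    finally show ?thesis
      by (simp only: filter sum_distrib_left)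
  qed
  have "{k::int. k \<in> {1..int n} \<and> regular_mod n k} =
      int ` {k. 1 \<le> k \<and> real k \<le> real n \<and> regular_mod n (int k)}" (is "?I = int ` ?N")
  proof
    show "?I \<subseteq> int ` ?N"
    proof
      fix k assume "k \<in> ?I"
      then show "k \<in> int ` ?N"
        by (intro image_eqI[of _ _ "nat k"]) auto
    qed
  qed auto
  then have "real (varrho n) = (\<Sum>k | 1 \<le> k \<and> real k \<le> real n \<and> regular_mod n (int k). 1)"
    by (simp add: varrho_def card_image)
  also have "\<dots> = (\<Sum>g\<in>G. \<epsilon> g * (\<Sum>k | 1 \<le> k \<and> real k \<le> real n \<and> d g dvd k. 1))"
    by (rule expand)
  also have "\<dots> = (\<Sum>g\<in>G. \<epsilon> g * (real n / real (d g)))"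
  proof (intro sum.cong refl arg_cong2[of _ _ _ _ "(*)"])
    fix g assume g: "g \<in> G"
    \<comment> \<open>As \<open>d g\<close> divides \<open>n\<close>, this quotient involves no
      rounding, so the formula for \<open>varrho n / n\<close> is exact.\<close>
    have "card {k. 1 \<le> k \<and> real k \<le> real n \<and> d g dvd k} = n div d g"
      unfolding multiples_le_eq_image[OF d_pos[OF g]] using d_pos[OF g]
      by (subst card_image) (auto simp: inj_on_def floor_divide_of_nat_eq)
    then show "(\<Sum>k | 1 \<le> k \<and> real k \<le> real n \<and> d g dvd k. 1) = real n / real (d g)"
      using d[OF g] by (simp add: real_of_nat_div)
  qed
  finally have "real (varrho n) / real n = (\<Sum>g\<in>G. \<epsilon> g / real (d g))"
    using n by (simp add: sum_divide_distrib)
  then have "\<bar>(\<Sum>k | 1 \<le> k \<and> real k \<le> x \<and> regular_mod n (int k). real k powr s)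
       - x powr (s + 1) / (s + 1) * (real (varrho n) / real n)\<bar> =
    \<bar>\<Sum>g\<in>G. \<epsilon> g * ((\<Sum>k | 1 \<le> k \<and> real k \<le> x \<and> d g dvd k. real k powr s)
       - x powr (s + 1) / (s + 1) / real (d g))\<bar>"
    unfolding expand by (simp add: right_diff_distrib sum_subtractf sum_distrib_left sum_divide_distrib mult_ac)
  \<comment> \<open>Each sign has absolute value 1, so each of the \<open>3 ^ omega n\<close> terms
    contributes at most \<open>x powr s\<close>; hence \<open>C = 1\<close>.\<close>
  also have "\<dots> \<le> (\<Sum>g\<in>G. x powr s)"
    using \<epsilon> d_pos x assms sum_powr_multiples[of s x]
    by (intro sum_abs[THEN order_trans] sum_mono) (simp add: abs_mult)
  also have "\<dots> = 1 * (x powr s * 3 ^ omega n)"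
    using G by simp
  finally show "\<bar>(\<Sum>k | 1 \<le> k \<and> real k \<le> x \<and> regular_mod n (int k). real k powr s)
       - x powr (s + 1) / (s + 1) * (real (varrho n) / real n)\<bar>
      \<le> 1 * (x powr s * 3 ^ omega n)" .
qed

end
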